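(* For each fixed integer $n\ge 1$, $a_n(FS_r)$ is a polynomial in $r$ of degree $n$ with no constant term; that is, there is a polynomial $P_n$ of degree exactly $n$ with $P_n(0)=0$ such that $a_n(FS_r)=P_n(r)$ for all integers $r\ge 1$.
   Context: $FS_r$ is the free semigroup of rank $r$, i.e. all non-empty words over an alphabet of $r$ letters under concatenation. The (Rees) index of a subsemigroup $T$ of a semigroup $S$ is $|S\setminus T|$, and $a_n(S)$ denotes the number of subsemigroups of $S$ of Rees index exactly $n$. *)

theory Defs
  imports Main "HOL-Computational_Algebra.Polynomial"
begin

(* Semigroups are given by a carrier set S and an operation f under which S is closed. *)

definition subsemigroup :: "'a set \<Rightarrow> ('a \<Rightarrow> 'a \<Rightarrow> 'a) \<Rightarrow> 'a set \<Rightarrow> bool" where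
  "subsemigroup S f T \<longleftrightarrow> T \<subseteq> S \<and> T \<noteq> {} \<and> (\<forall>x\<in>T. \<forall>y\<in>T. f x y \<in> T)"

(* Finiteness is explicit because card is 0 on infinite sets. *)
definition has_rees_index :: "'a set \<Rightarrow> 'a set \<Rightarrow> nat \<Rightarrow> bool" where
  "has_rees_index S T n \<longleftrightarrow> finite (S - T) \<and> card (S - T) = n"

definition subsemigroups_of_index :: "nat \<Rightarrow> 'a set \<Rightarrow> ('a \<Rightarrow> 'a \<Rightarrow> 'a) \<Rightarrow> 'a set set" where
  "subsemigroups_of_index n S f = {T. subsemigroup S f T \<and> has_rees_index S T n}"

(* The number a_n(S); meaningful when there are finitely many such subsemigroups. *)
definition num_subsemigroups :: "nat \<Rightarrow> 'a set \<Rightarrow> ('a \<Rightarrow> 'a \<Rightarrow> 'a) \<Rightarrow> nat" where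
  "num_subsemigroups n S f = card (subsemigroups_of_index n S f)"

(* The carrier of FS_r, with alphabet {0, ..., r - 1}; its operation is concatenation (@). *)
definition free_semigroup :: "nat \<Rightarrow> nat list set" where
  "free_semigroup r = {w. w \<noteq> [] \<and> set w \<subseteq> {..<r}}"

end

theory Submission
  imports Defs
begin

text \<open>
  A set of words is the complement of a subsemigroup iff every factorization of a member
  into two non-empty words has a factor in the set. Removing a longest word from a finite set of
  this kind leaves a set of the same kind, and it loses at most one letter: a word with two letters
  outside the smaller set could be cut between them. Hence \<open>n\<close> words use at most \<open>n\<close> letters,
  with equality for \<open>n\<close> single letters. If \<open>c k\<close> such sets have letter set exactly
  \<open>{0, \<dots>, k - 1}\<close>, renaming letters gives \<open>a\<^sub>n(FS\<^sub>r) = (\<Sum>k\<le>n. c k * (r choose k))\<close>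
  with \<open>c 0 = 0\<close> and \<open>c n > 0\<close>.
\<close>

section \<open>Complements of subsemigroups: bounds on word length and on letters\<close>

definition split_closed :: "'a list set \<Rightarrow> bool" where
  "split_closed F \<longleftrightarrow> [] \<notin> F \<and>
    (\<forall>u v. u \<noteq> [] \<longrightarrow> v \<noteq> [] \<longrightarrow> u @ v \<in> F \<longrightarrow> u \<in> F \<or> v \<in> F)"

definition letters :: "'a list set \<Rightarrow> 'a set" where
  "letters F = (\<Union>w\<in>F. set w)"

definition split_closed_sets :: "nat \<Rightarrow> 'a set \<Rightarrow> 'a list set set" where
  "split_closed_sets n A = {F. split_closed F \<and> finite F \<and> card F = n \<and> letters F = A}"

lemma split_closedD:
  assumes "split_closed F" "w \<in> F" "0 < i" "i < length w"
  shows "take i w \<in> F \<or> drop i w \<in> F"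
proof -
  have "take i w @ drop i w \<in> F" "take i w \<noteq> []" "drop i w \<noteq> []"
    using assms by auto
  then show ?thesis
    using assms(1) unfolding split_closed_def by blast
qed

text \<open>Each cut in the first half of \<open>w\<close> puts a factor into \<open>F\<close>, and
  cuts at different positions give different words, so \<open>w\<close> cannot be long. Over a
  finite alphabet this leaves only finitely many candidates for \<open>F\<close>.\<close>

lemma split_closed_length:
  assumes "split_closed F" "finite F" "w \<in> F"
  shows "length w \<le> 2 * card F + 1"
proof -
  \<comment> \<open>\<open>?m\<close> recovers the cut position i from either factor, because i is
    at most half of \<open>length w\<close>. Members of \<open>F\<close> longer than
    \<open>w\<close> are sent to 0 by truncated subtraction, which does not affect the
    inclusion.\<close>
  let ?m = "\<lambda>x. min (length x) (length w - length x)"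
  have "{1..length w div 2} \<subseteq> ?m ` F"
  proof
    fix i assume i: "i \<in> {1..length w div 2}"
    then have "take i w \<in> F \<or> drop i w \<in> F"
      using split_closedD[OF assms(1,3), of i] by auto
    moreover have "?m (take i w) = i" "?m (drop i w) = i"
      using i by auto
    ultimately show "i \<in> ?m ` F"
      by (metis (no_types, lifting) image_eqI)
  qed
  then have "card {1..length w div 2} \<le> card (?m ` F)"
    using assms(2) by (intro card_mono) auto
  also have "\<dots> \<le> card F"
    using assms(2) by (rule card_image_le)
  finally show ?thesis by simp
qed

text \<open>Proper factors of a member are strictly shorter than \<open>w\<close>, so removing
  \<open>w\<close> removes no factor that a cut relies on.\<close>

lemma split_closed_remove_longest:
  assumes "split_closed F" "\<And>x. x \<in> F \<Longrightarrow> length x \<le> length w"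
  shows "split_closed (F - {w})"
  unfolding split_closed_def
proof (intro conjI allI impI)
  show "[] \<notin> F - {w}"
    using assms(1) by (auto simp: split_closed_def)
  fix u v :: "'a list" assume uv: "u \<noteq> []" "v \<noteq> []" "u @ v \<in> F - {w}"
  then have "length u < length w" "length v < length w"
    using assms(2)[of "u @ v"] by (auto simp flip: length_greater_0_conv)
  then have "u \<noteq> w" "v \<noteq> w" by auto
  then show "u \<in> F - {w} \<or> v \<in> F - {w}"
    using assms(1) uv unfolding split_closed_def by blast
qed

lemma new_letters_singleton:
  assumes split: "\<And>i. 0 < i \<Longrightarrow> i < length w \<Longrightarrow> set (take i w) \<subseteq> L \<or> set (drop i w) \<subseteq> L"
  shows "\<exists>a. set w \<subseteq> insert a L"
proof (cases "set w \<subseteq> L")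
  case False
  then obtain u a v where w: "w = u @ a # v" "a \<notin> L" "set u \<subseteq> L"
    using split_list_first_prop[of w "\<lambda>x. x \<notin> L"] by blast
  \<comment> \<open>Cut right behind \<open>a\<close>, the first letter outside \<open>L\<close>:
    the left factor contains \<open>a\<close>, so the right one must lie in \<open>L\<close>. An
    empty \<open>v\<close> admits no such cut.\<close>
  have "set v \<subseteq> L"
  proof (cases "v = []")
    case False
    then show ?thesis
      using split[of "Suc (length u)"] w by auto
  qed simp
  then show ?thesis using w by auto
qed auto

lemma split_closed_letters:
  assumes "split_closed F" "finite F"
  shows "finite (letters F) \<and> card (letters F) \<le> card F"
  using assms
proof (induction "card F" arbitrary: F)
  case 0
  then show ?case by (simp add: letters_def)
next
  case (Suc n)
  then have "F \<noteq> {}" by auto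
  then obtain w where w: "w \<in> F" and longest: "\<And>x. x \<in> F \<Longrightarrow> length x \<le> length w"
    using Max_in[of "length ` F"] Max_ge[of "length ` F"] Suc.prems(2) by fastforce
  let ?G = "F - {w}"
  have G: "split_closed ?G"
    using Suc.prems(1) longest by (rule split_closed_remove_longest)
  have cardG: "n = card ?G"
    using Suc.hyps(2) Suc.prems(2) w by simp
  have IH: "finite (letters ?G)" "card (letters ?G) \<le> card ?G"
    using Suc.hyps(1)[OF cardG G] Suc.prems(2) by auto
  have "set (take i w) \<subseteq> letters ?G \<or> set (drop i w) \<subseteq> letters ?G"
    if "0 < i" "i < length w" for i
  proof -
    \<comment> \<open>Both factors differ from \<open>w\<close>, so the one that lies in
      \<open>F\<close> survives in \<open>?G\<close>.\<close>
    have "take i w \<noteq> w" "drop i w \<noteq> w"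
      using that by (auto dest!: arg_cong[where f = length])
    then show ?thesis
      using split_closedD[OF Suc.prems(1) w that] by (auto simp: letters_def)
  qed
  then obtain a where "set w \<subseteq> insert a (letters ?G)"
    using new_letters_singleton by blast
  then have sub: "letters F \<subseteq> insert a (letters ?G)"
    unfolding letters_def by blast
  then have "card (letters F) \<le> card (insert a (letters ?G))"
    using IH(1) by (intro card_mono) auto
  also have "\<dots> \<le> Suc n"
    using IH cardG by (simp add: card_insert_if)
  finally show ?case
    using sub IH(1) Suc.hyps(2) by (metis finite_insert finite_subset)
qed

section \<open>Renaming letters\<close>

lemma split_closed_map_image:
  assumes "split_closed F"
  shows "split_closed (map h ` F)"
  unfolding split_closed_def
proof (intro conjI allI impI)
  show "[] \<notin> map h ` F"
    using assms by (auto simp: split_closed_def)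
  fix u v assume uv: "u \<noteq> []" "v \<noteq> []" "u @ v \<in> map h ` F"
  then obtain w where "w \<in> F" "map h w = u @ v"
    by (metis imageE)
  \<comment> \<open>A cut of \<open>map h w\<close> lifts to the cut of \<open>w\<close> at the same
    position.\<close>
  then obtain x y where "u = map h x" "v = map h y" "x @ y \<in> F"
    by (auto simp: map_eq_append_conv)
  moreover from this uv have "x \<noteq> []" "y \<noteq> []"
    by auto
  ultimately show "u \<in> map h ` F \<or> v \<in> map h ` F"
    using assms unfolding split_closed_def by blast
qed

text \<open>Injectivity on the letters makes \<open>map h\<close> injective on \<open>F\<close>, so
  no two words merge and the size stays n.\<close>

lemma split_closed_sets_rename:
  assumes "inj_on h A" "F \<in> split_closed_sets n A"
  shows "map h ` F \<in> split_closed_sets n (h ` A)"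
proof -
  have "inj_on (map h) F"
    using assms by (intro inj_on_mapI) (auto simp: split_closed_sets_def letters_def)
  moreover have "letters (map h ` F) = h ` letters F"
    by (auto simp: letters_def)
  ultimately show ?thesis
    using assms by (auto simp: split_closed_sets_def split_closed_map_image card_image)
qed

lemma map_image_inverse:
  assumes "\<And>x. x \<in> letters F \<Longrightarrow> g (h x) = x"
  shows "map g ` map h ` F = F"
proof -
  have "map g (map h w) = w" if "w \<in> F" for w
    unfolding map_map using assms that by (intro map_idI) (auto simp: letters_def)
  then show ?thesis by (force simp: image_image)
qed

lemma card_split_closed_sets:
  assumes "bij_betw h A B"
  shows "card (split_closed_sets n A) = card (split_closed_sets n B)"
proof -
  let ?g = "inv_into A h"
  have g: "bij_betw ?g B A"
    using assms by (rule bij_betw_inv_into)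
  have "bij_betw (\<lambda>F. map h ` F) (split_closed_sets n A) (split_closed_sets n B)"
  proof (rule bij_betw_byWitness[where f' = "\<lambda>F. map ?g ` F"])
    show "\<forall>F\<in>split_closed_sets n A. map ?g ` map h ` F = F"
      using assms by (intro ballI map_image_inverse)
        (auto simp: split_closed_sets_def bij_betw_def)
    show "\<forall>F\<in>split_closed_sets n B. map h ` map ?g ` F = F"
      using assms by (intro ballI map_image_inverse)
        (auto simp: split_closed_sets_def bij_betw_def f_inv_into_f)
    show "(\<lambda>F. map h ` F) ` split_closed_sets n A \<subseteq> split_closed_sets n B"
      using assms split_closed_sets_rename[of h A] by (auto simp: bij_betw_def)
    show "(\<lambda>F. map ?g ` F) ` split_closed_sets n B \<subseteq> split_closed_sets n A"
      using g split_closed_sets_rename[of ?g B] by (auto simp: bij_betw_def)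
  qed
  then show ?thesis by (rule bij_betw_same_card)
qed

section \<open>Finiteness and vanishing of the coefficients\<close>

lemma finite_split_closed_sets:
  assumes "finite A"
  shows "finite (split_closed_sets n A)"
proof (rule finite_subset)
  show "split_closed_sets n A \<subseteq> Pow {w. set w \<subseteq> A \<and> length w \<le> 2 * n + 1}"
    using split_closed_length by (fastforce simp: split_closed_sets_def letters_def)
  show "finite (Pow {w. set w \<subseteq> A \<and> length w \<le> 2 * n + 1})"
    using finite_lists_length_le[OF assms] by simp
qed

text \<open>This stops the sum over k at n for every r, so that one polynomial serves all r.\<close>

lemma split_closed_sets_eq_empty:
  assumes "n < card A"
  shows "split_closed_sets n A = {}"
  using split_closed_letters assms by (fastforce simp: split_closed_sets_def)

lemma split_closed_sets_no_letters:
  assumes "n \<ge> 1"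
  shows "split_closed_sets n {} = {}"
proof -
  have False if "F \<in> split_closed_sets n {}" for F :: "'a list set"
  proof -
    have "F \<noteq> {}" "[] \<notin> F" "\<And>w. w \<in> F \<Longrightarrow> set w = {}"
      using that assms by (auto simp: split_closed_sets_def split_closed_def letters_def)
    then show False by auto
  qed
  then show ?thesis by blast
qed

text \<open>Single letters have no factorization into non-empty words. This witness makes the
  leading coefficient non-zero.\<close>

lemma single_letters_in_split_closed_sets:
  assumes "finite A"
  shows "(\<lambda>a. [a]) ` A \<in> split_closed_sets (card A) A"
  using assms
  by (auto simp: split_closed_sets_def split_closed_def letters_def card_image inj_on_def
      append_eq_Cons_conv)

section \<open>Counting subsemigroups through their complements\<close>

lemma subsemigroups_of_index_free_semigroup_iff:
  assumes "r \<ge> 1"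
  shows "T \<in> subsemigroups_of_index n (free_semigroup r) (@) \<longleftrightarrow>
    T \<subseteq> free_semigroup r \<and> (\<exists>A\<subseteq>{..<r}. free_semigroup r - T \<in> split_closed_sets n A)"
proof -
  let ?S = "free_semigroup r"
  \<comment> \<open>The witness for \<open>A\<close> is the letter set of the complement.\<close>
  have letters: "letters (?S - T) \<subseteq> {..<r}"
    by (auto simp: letters_def free_semigroup_def)
  have closed: "(\<forall>x\<in>T. \<forall>y\<in>T. x @ y \<in> T) \<longleftrightarrow> split_closed (?S - T)" if "T \<subseteq> ?S"
  proof
    assume "\<forall>x\<in>T. \<forall>y\<in>T. x @ y \<in> T"
    then show "split_closed (?S - T)"
      by (auto simp: split_closed_def free_semigroup_def)
  next
    assume sc: "split_closed (?S - T)"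
    show "\<forall>x\<in>T. \<forall>y\<in>T. x @ y \<in> T"
    proof (intro ballI, rule ccontr)
      fix x y assume xy: "x \<in> T" "y \<in> T" "x @ y \<notin> T"
      then have "x \<in> ?S" "y \<in> ?S" using that by auto
      then have "x @ y \<in> ?S - T" "x \<noteq> []" "y \<noteq> []"
        using xy by (auto simp: free_semigroup_def)
      then show False
        using sc xy unfolding split_closed_def by blast
    qed
  qed
  \<comment> \<open>A subsemigroup must be non-empty. A finite complement ensures this, since the
    powers of the letter 0, available as r \<ge> 1, make the carrier infinite.\<close>
  have "infinite ?S"
  proof
    assume "finite ?S"
    then have "finite ((\<lambda>k. replicate (Suc k) (0::nat)) ` UNIV)"
      using assms by (rule_tac finite_subset[of _ ?S]) (auto simp: free_semigroup_def)
    then show False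
      by (rule finite_imageD[THEN infinite_UNIV_nat[THEN notE]])
        (auto simp: inj_on_def dest: arg_cong[where f = length])
  qed
  then have "T \<noteq> {}" if "finite (?S - T)"
    using that by auto
  then show ?thesis
    using closed letters
    by (auto simp: subsemigroups_of_index_def subsemigroup_def has_rees_index_def
        split_closed_sets_def)
qed

lemma bij_betw_complement:
  assumes "r \<ge> 1"
  shows "bij_betw (\<lambda>T. free_semigroup r - T) (subsemigroups_of_index n (free_semigroup r) (@))
    (\<Union>A\<in>Pow {..<r}. split_closed_sets n A)"
proof -
  let ?S = "free_semigroup r"
  let ?c = "\<lambda>T. ?S - T"
  \<comment> \<open>Taking the complement twice gives back \<open>F\<close> only if \<open>F\<close>
    lies inside the carrier.\<close>
  have sub: "F \<subseteq> ?S" if "A \<subseteq> {..<r}" "F \<in> split_closed_sets n A" for A F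
    using that by (auto simp: split_closed_sets_def split_closed_def letters_def free_semigroup_def)
  show ?thesis
  proof (rule bij_betw_byWitness[where f' = ?c])
    show "\<forall>T\<in>subsemigroups_of_index n ?S (@). ?c (?c T) = T"
      using subsemigroups_of_index_free_semigroup_iff[OF assms] by blast
    show "\<forall>F\<in>\<Union>(split_closed_sets n ` Pow {..<r}). ?c (?c F) = F"
      using sub by blast
    show "?c ` subsemigroups_of_index n ?S (@) \<subseteq> \<Union>(split_closed_sets n ` Pow {..<r})"
      by (rule image_subsetI) (auto simp: subsemigroups_of_index_free_semigroup_iff[OF assms])
    show "?c ` \<Union>(split_closed_sets n ` Pow {..<r}) \<subseteq> subsemigroups_of_index n ?S (@)"
    proof (rule image_subsetI)
      fix F assume "F \<in> \<Union>(split_closed_sets n ` Pow {..<r})"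
      then obtain A where A: "A \<subseteq> {..<r}" "F \<in> split_closed_sets n A" by blast
      then have "?c (?c F) = F"
        using sub double_diff by blast
      then have "\<exists>A\<subseteq>{..<r}. ?c (?c F) \<in> split_closed_sets n A"
        using A by auto
      then show "?c F \<in> subsemigroups_of_index n ?S (@)"
        unfolding subsemigroups_of_index_free_semigroup_iff[OF assms] by blast
    qed
  qed
qed

lemma num_subsemigroups_free_semigroup:
  assumes "r \<ge> 1"
  shows "num_subsemigroups n (free_semigroup r) (@) =
    (\<Sum>k\<le>n. (r choose k) * card (split_closed_sets n {..<k}))"
proof -
  let ?c = "\<lambda>k. card (split_closed_sets n {..<k::nat})"
  have c: "card (split_closed_sets n A) = ?c (card A)" if "A \<subseteq> {..<r}" for A
  proof -
    have "finite A" using that finite_subset by blast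
    then obtain h where "bij_betw h A {..<card A}"
      using ex_bij_betw_finite_nat[of A] by (auto simp: atLeast0LessThan)
    then show ?thesis by (rule card_split_closed_sets)
  qed
  have "num_subsemigroups n (free_semigroup r) (@) = card (\<Union>A\<in>Pow {..<r}. split_closed_sets n A)"
    unfolding num_subsemigroups_def by (rule bij_betw_same_card[OF bij_betw_complement[OF assms]])
  \<comment> \<open>The union is disjoint because a set of words determines its letter set.\<close>
  also have "\<dots> = (\<Sum>A\<in>Pow {..<r}. card (split_closed_sets n A))"
  proof (rule card_UN_disjoint)
    show "\<forall>A\<in>Pow {..<r}. finite (split_closed_sets n A)"
      using finite_split_closed_sets finite_subset[OF _ finite_lessThan] by blast
  qed (auto simp: split_closed_sets_def)
  also have "\<dots> = (\<Sum>A\<in>Pow {..<r}. ?c (card A))"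
    using c by simp
  also have "\<dots> = (\<Sum>k\<le>r. \<Sum>A | A \<in> Pow {..<r} \<and> card A = k. ?c (card A))"
  proof (rule sum.group[symmetric])
    show "card ` Pow {..<r} \<subseteq> {..r}"
      using card_mono[OF finite_lessThan[of r]] by auto
  qed auto
  also have "\<dots> = (\<Sum>k\<le>r. (r choose k) * ?c k)"
    using n_subsets[of "{..<r}"] by (intro sum.cong) auto
  \<comment> \<open>The bound passes from r to n through their maximum: terms with k > r vanish by
    the binomial coefficient, terms with k > n by \<open>?c k = 0\<close>.\<close>
  also have "\<dots> = (\<Sum>k\<le>max r n. (r choose k) * ?c k)"
    by (rule sum.mono_neutral_left) auto
  also have "\<dots> = (\<Sum>k\<le>n. (r choose k) * ?c k)"
    by (rule sum.mono_neutral_right) (auto simp: split_closed_sets_eq_empty)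
  finally show ?thesis .
qed

section \<open>Binomial coefficients as polynomials in the upper argument, and the final
  assembly\<close>

definition binomial_poly :: "nat \<Rightarrow> 'a::field_char_0 poly" where
  "binomial_poly k = smult (1 / fact k) (\<Prod>i<k. [:- of_nat i, 1:])"

lemma poly_binomial_poly: "poly (binomial_poly k) x = x gchoose k"
  by (simp add: binomial_poly_def poly_prod gbinomial_prod_rev atLeast0LessThan)

text \<open>There are k monic linear factors, and the scalar \<open>1 / fact k\<close> is
  non-zero.\<close>

lemma degree_binomial_poly: "degree (binomial_poly k) = k"
  by (simp add: binomial_poly_def degree_prod_sum_eq)

theorem theorem5p2:
  fixes n :: nat
  assumes "n \<ge> 1"
  shows "\<exists>P :: rat poly. degree P = n \<and> poly P 0 = 0 \<and>
    (\<forall>r\<ge>1. finite (subsemigroups_of_index n (free_semigroup r) (@)) \<and>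
      of_nat (num_subsemigroups n (free_semigroup r) (@)) = poly P (of_nat r))"
proof -
  let ?c = "\<lambda>k. card (split_closed_sets n {..<k::nat})"
  define t :: "nat \<Rightarrow> rat poly" where "t = (\<lambda>k. smult (of_nat (?c k)) (binomial_poly k))"
  define P where "P = (\<Sum>k\<le>n. t k)"
  have c0: "?c 0 = 0"
    by (simp add: split_closed_sets_no_letters[OF assms])
  have cn: "?c n \<noteq> 0"
    using single_letters_in_split_closed_sets[of "{..<n}"] finite_split_closed_sets[of "{..<n}" n]
    by auto
  \<comment> \<open>This holds for r = 0 too, which later yields the constant term.\<close>
  have poly_P: "poly P (of_nat r) = of_nat (\<Sum>k\<le>n. (r choose k) * ?c k)" for r
    by (simp add: P_def t_def poly_sum poly_binomial_poly binomial_gbinomial mult.commute)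
  \<comment> \<open>Each \<open>t k\<close> has degree at most k, so the terms below n cannot cancel
    the leading term of \<open>t n\<close>.\<close>
  have deg_lower: "degree (\<Sum>k<n. t k) < n"
    using assms by (intro degree_sum_less) (auto simp: t_def degree_binomial_poly)
  have "degree P = n"
    using deg_lower cn degree_add_eq_right[of "\<Sum>k<n. t k" "t n"]
    by (simp add: P_def lessThan_Suc_atMost[symmetric] t_def degree_binomial_poly)
  moreover have "poly P 0 = 0"
  proof -
    have "(\<Sum>k\<le>n. (0 choose k) * ?c k) = 0"
    proof (intro sum.neutral ballI)
      \<comment> \<open>For k = 0 the second factor is 0 by \<open>c0\<close>; for k > 0 the
        binomial coefficient is 0.\<close>
      fix k show "(0 choose k) * ?c k = 0"
        using c0 by (cases k) simp_all
    qed
    then show ?thesis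
      using poly_P[of 0] by (simp only: of_nat_0)
  qed
  \<comment> \<open>Finiteness is what makes the value of \<open>num_subsemigroups\<close> a true
    count, as \<open>card\<close> is 0 on infinite sets.\<close>
  moreover have "finite (subsemigroups_of_index n (free_semigroup r) (@))" if "r \<ge> 1" for r
  proof -
    have "finite (split_closed_sets n A)" if "A \<subseteq> {..<r}" for A
      using finite_split_closed_sets[OF finite_subset[OF that finite_lessThan]] .
    then have "finite (\<Union>A\<in>Pow {..<r}. split_closed_sets n A)"
      by blast
    then show ?thesis
      using bij_betw_finite[OF bij_betw_complement[OF that]] by blast
  qed
  moreover have "of_nat (num_subsemigroups n (free_semigroup r) (@)) = poly P (of_nat r)"
    if "r \<ge> 1" for r
    using num_subsemigroups_free_semigroup[OF that] poly_P by simp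
  ultimately show ?thesis by blast
qed

end
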